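(* Let $n\ge2$ and let $a_1,\ldots,a_n$ be nonnegative integers. Consider, for functions $v$ of the independent variables $x_1,\ldots,x_{n-1}$, the PDE $$ \sum_{i=1}^{n-1}x_i(1-x_i)\partial_i^2v-2\sum_{1\le i<j\le n-1}x_ix_j\partial_i\partial_jv+\sum_{i=1}^{n-1}\bigl((a_1+\cdots+a_n)x_i-a_i\bigr)\partial_iv=0,\qquad(\ast) $$ where $\partial_i=\partial/\partial x_i$, and put $x_n:=1-x_1-\cdots-x_{n-1}$. Then for every permutation $\sigma$ of $1,2,\ldots,n$ the function $$ (x_1,\ldots,x_{n-1})\mapsto f_{a_{\sigma(1)},\ldots,a_{\sigma(n)}}(x_{\sigma(1)},\ldots,x_{\sigma(n)}) $$ is a solution of $(\ast)$. Up to a constant factor it is the unique solution of $(\ast)$ of the form $$ v(x_1,\ldots,x_{n-1})=x_{\sigma(n)}^{a_{\sigma(n)}+1}\sum_{k_1=0}^{a_{\sigma(1)}}\cdots\sum_{k_{n-1}=0}^{a_{\sigma(n-1)}}\gamma_{k_1,\ldots,k_{n-1}}\,x_{\sigma(1)}^{k_1}\cdots x_{\sigma(n-1)}^{k_{n-1}} $$ with constant coefficients $\gamma_{k_1,\ldots,k_{n-1}}$.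
   Context: $(a)_k$ is the Pochhammer symbol: $(a)_0=1$ and $(a)_k=a(a+1)\cdots(a+k-1)$ for $k\ge1$. For nonnegative integers $b_1,\ldots,b_n$ and $y_1+\cdots+y_n=1$, $$ f_{b_1,\ldots,b_n}(y_1,\ldots,y_n):=y_n^{b_n+1}\sum_{k_1=0}^{b_1}\cdots\sum_{k_{n-1}=0}^{b_{n-1}}\frac{(b_n+1)_{k_1+\cdots+k_{n-1}}}{k_1!\cdots k_{n-1}!}\,y_1^{k_1}\cdots y_{n-1}^{k_{n-1}}. $$ *)

theory Defs
  imports "HOL-Analysis.Analysis"
begin

(* A point (x_1,...,x_m) is represented by x :: nat => 'a, of which only the
   entries x 1,...,x m are relevant; depends_on_first m v says that v really is
   a function of these m variables. *)
definition depends_on_first :: "nat \<Rightarrow> ((nat \<Rightarrow> 'a) \<Rightarrow> 'b) \<Rightarrow> bool" where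
  "depends_on_first m v \<longleftrightarrow> (\<forall>x y. (\<forall>i\<in>{1..m}. x i = y i) \<longrightarrow> v x = v y)"

definition slice :: "nat \<Rightarrow> ((nat \<Rightarrow> 'a) \<Rightarrow> 'b) \<Rightarrow> (nat \<Rightarrow> 'a) \<Rightarrow> 'a \<Rightarrow> 'b" where
  "slice i v x = (\<lambda>t. v (x(i := t)))"

definition pderiv_ex :: "nat \<Rightarrow> ((nat \<Rightarrow> 'a::real_normed_field) \<Rightarrow> 'a) \<Rightarrow> bool" where
  "pderiv_ex i v \<longleftrightarrow> (\<forall>x. slice i v x field_differentiable at (x i))"

definition partial :: "nat \<Rightarrow> ((nat \<Rightarrow> 'a::real_normed_field) \<Rightarrow> 'a) \<Rightarrow> (nat \<Rightarrow> 'a) \<Rightarrow> 'a" where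
  "partial i v x = deriv (slice i v x) (x i)"

(* C^2 in the variables x_1,...,x_m.  Continuity refers to the product topology
   on nat => 'a; for a function that depends only on x_1,...,x_m this is the
   usual joint continuity in these m variables. *)
definition twice_cont_diff :: "nat \<Rightarrow> ((nat \<Rightarrow> 'a::real_normed_field) \<Rightarrow> 'a) \<Rightarrow> bool" where
  "twice_cont_diff m v \<longleftrightarrow>
     depends_on_first m v \<and> continuous_on UNIV v \<and>
     (\<forall>i\<in>{1..m}. pderiv_ex i v \<and> continuous_on UNIV (partial i v) \<and>
        (\<forall>j\<in>{1..m}. pderiv_ex j (partial i v) \<and>
                   continuous_on UNIV (partial j (partial i v))))"

definition pde_solution ::
    "nat \<Rightarrow> (nat \<Rightarrow> nat) \<Rightarrow> ((nat \<Rightarrow> 'a::real_normed_field) \<Rightarrow> 'a) \<Rightarrow> bool" where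
  "pde_solution n a v \<longleftrightarrow>
     twice_cont_diff (n - 1) v \<and>
     (\<forall>x. (\<Sum>i\<in>{1..n-1}. x i * (1 - x i) * partial i (partial i v) x)
          - 2 * (\<Sum>i\<in>{1..n-1}. \<Sum>j\<in>{i<..n-1}. x i * x j * partial i (partial j v) x)
          + (\<Sum>i\<in>{1..n-1}. (of_nat (\<Sum>l\<in>{1..n}. a l) * x i - of_nat (a i)) * partial i v x)
          = 0)"

(* Extends (x_1,...,x_(n-1)) by x_n = 1 - x_1 - ... - x_(n-1). *)
definition complete_point :: "nat \<Rightarrow> (nat \<Rightarrow> 'a::real_normed_field) \<Rightarrow> nat \<Rightarrow> 'a" where
  "complete_point n x = x(n := 1 - (\<Sum>i\<in>{1..n-1}. x i))"

(* The set of all (k_1,...,k_(n-1)) with 0 <= k_i <= b_i. *)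
definition multi_indices :: "nat \<Rightarrow> (nat \<Rightarrow> nat) \<Rightarrow> (nat \<Rightarrow> nat) set" where
  "multi_indices n b = (\<Pi>\<^sub>E i\<in>{1..n-1}. {0..b i})"

(* The polynomial f_(b_1,...,b_n)(y_1,...,y_n); the constraint
   y_1 + ... + y_n = 1 is imposed where the function is applied. *)
definition f_poly :: "nat \<Rightarrow> (nat \<Rightarrow> nat) \<Rightarrow> (nat \<Rightarrow> 'a::real_normed_field) \<Rightarrow> 'a" where
  "f_poly n b y = y n ^ (b n + 1) *
     (\<Sum>k\<in>multi_indices n b.
        pochhammer (of_nat (b n + 1)) (\<Sum>i\<in>{1..n-1}. k i) / (\<Prod>i\<in>{1..n-1}. fact (k i))
        * (\<Prod>i\<in>{1..n-1}. y i ^ k i))"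

(* Same shape as f_poly, but with arbitrary constant coefficients gamma_k. *)
definition f_form ::
    "nat \<Rightarrow> (nat \<Rightarrow> nat) \<Rightarrow> ((nat \<Rightarrow> nat) \<Rightarrow> 'a) \<Rightarrow> (nat \<Rightarrow> 'a::real_normed_field) \<Rightarrow> 'a" where
  "f_form n b \<gamma> y = y n ^ (b n + 1) *
     (\<Sum>k\<in>multi_indices n b. \<gamma> k * (\<Prod>i\<in>{1..n-1}. y i ^ k i))"

end

theory Submission
  imports Defs
begin

text \<open>
  Although the equation is written in the variables \<open>x\<^sub>1, \<dots>, x\<^sub>n\<^sub>-\<^sub>1\<close>, it treats the
  barycentric coordinates \<open>y\<^sub>1, \<dots>, y\<^sub>n\<close> (with \<open>y\<^sub>n = 1 - y\<^sub>1 - \<dots> - y\<^sub>n\<^sub>-\<^sub>1\<close>) symmetrically.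
  If a function \<open>V\<close> of \<open>n\<close> variables is restricted to the hyperplane \<open>y\<^sub>1 + \<dots> + y\<^sub>n = 1\<close>, then
  \<open>\<partial>\<^sub>i\<close> becomes \<open>V\<^sub>i - V\<^sub>n\<close>, and the left-hand side of the equation turns into
  \<open>\<Sum>\<^sub>i y\<^sub>i V\<^sub>i\<^sub>i - \<Sum>\<^sub>i\<^sub>,\<^sub>j y\<^sub>i y\<^sub>j V\<^sub>i\<^sub>j + \<Sum>\<^sub>i (A y\<^sub>i - a\<^sub>i) V\<^sub>i\<close> with all sums over \<open>1, \<dots>, n\<close> and
  \<open>A = a\<^sub>1 + \<dots> + a\<^sub>n\<close> (lemma \<open>pde_form_barycentric\<close>).
  In this form the permutation \<open>\<sigma>\<close> only relabels indices, so no change of variables is needed.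

  By Euler's identities a monomial \<open>y\<^sup>m\<close> of total degree \<open>K\<close> is sent to
  \<open>\<Sum>\<^sub>i m\<^sub>i (m\<^sub>i - 1 - a\<^sub>i) y\<^sup>m / y\<^sub>i - K (K - 1 - A) y\<^sup>m\<close> (lemma \<open>pde_form_bary_monomial\<close>).
  For the monomials in question the exponent of \<open>y\<^bsub>\<sigma> n\<^esub>\<close> is \<open>a\<^bsub>\<sigma> n\<^esub> + 1\<close>, which makes the
  corresponding summand vanish. Hence the space of functions of the prescribed form is
  preserved. With \<open>b = a \<circ> \<sigma>\<close>, on coefficients the operator acts as
  \<open>\<gamma> \<mapsto> (k \<mapsto> \<Sum>\<^sub>l (k\<^sub>l - b\<^sub>l) ((k\<^sub>l + 1) \<gamma>(k + e\<^sub>l) - K \<gamma>(k)))\<close>, where \<open>l\<close> runs over \<open>1, \<dots>, n - 1\<close> and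
  \<open>K = b\<^sub>n + 1 + k\<^sub>1 + \<dots> + k\<^sub>n\<^sub>-\<^sub>1\<close> (lemma \<open>pde_operator_f_form\<close>). Since a polynomial that vanishes
  on an infinite grid has zero coefficients, being a solution is equivalent to this
  expression being zero for all \<open>k\<close> in the box \<open>0 \<le> k\<^sub>l \<le> b\<^sub>l\<close>.

  For the Pochhammer coefficients every bracket vanishes, which gives existence. For uniqueness,
  the factor \<open>k\<^sub>l - b\<^sub>l\<close> cuts off the terms that would leave the box, so the recurrence expresses
  \<open>K \<Sum>\<^sub>l (b\<^sub>l - k\<^sub>l) \<gamma>(k)\<close> through values of \<open>\<gamma>\<close> at larger indices. As the scalar in front is
  nonzero unless \<open>k = b\<close>, all coefficients are determined by the one in the top corner of the
  box (lemma \<open>recurrence_determined_by_top\<close>).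
\<close>

section \<open>Partial derivatives of monomials in barycentric coordinates\<close>

text \<open>
  A relational form of \<open>partial\<close> which, unlike the function itself, yields existence and value of
  the derivative together and is closed under linear combinations.
\<close>

definition has_partial :: "nat \<Rightarrow> ((nat \<Rightarrow> 'a::real_normed_field) \<Rightarrow> 'a) \<Rightarrow> ((nat \<Rightarrow> 'a) \<Rightarrow> 'a) \<Rightarrow> bool" where
  "has_partial i u u' \<longleftrightarrow> (\<forall>x. (slice i u x has_field_derivative u' x) (at (x i)))"

lemma has_partial_pderiv_ex: "has_partial i u u' \<Longrightarrow> pderiv_ex i u"
  by (auto simp: has_partial_def pderiv_ex_def field_differentiable_def)

lemma has_partial_partial: "has_partial i u u' \<Longrightarrow> partial i u = u'"
  by (auto simp: has_partial_def partial_def fun_eq_iff intro!: DERIV_imp_deriv)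

lemma has_partial_diff_cmult:
  assumes "has_partial i u u'" "has_partial i w w'"
  shows "has_partial i (\<lambda>x. c * u x - d * w x) (\<lambda>x. c * u' x - d * w' x)"
  using assms unfolding has_partial_def slice_def
  by (intro allI DERIV_diff DERIV_cmult) auto

lemma has_partial_linear_combination:
  assumes "\<And>s. s \<in> S \<Longrightarrow> has_partial i (u s) (u' s)"
  shows "has_partial i (\<lambda>x. \<Sum>s\<in>S. c s * u s x) (\<lambda>x. \<Sum>s\<in>S. c s * u' s x)"
  using assms unfolding has_partial_def slice_def
  by (intro allI DERIV_sum DERIV_cmult) auto

definition dec :: "nat \<Rightarrow> (nat \<Rightarrow> nat) \<Rightarrow> nat \<Rightarrow> nat" where
  "dec i m = m(i := m i - 1)"

definition monomial :: "nat \<Rightarrow> (nat \<Rightarrow> nat) \<Rightarrow> (nat \<Rightarrow> 'a::comm_monoid_mult) \<Rightarrow> 'a" where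
  "monomial n m y = (\<Prod>i\<in>{1..n}. y i ^ m i)"

text \<open>
  The monomial \<open>y\<^sup>m\<close> in all \<open>n\<close> barycentric coordinates, as a function of the independent
  variables \<open>x\<^sub>1, \<dots>, x\<^sub>n\<^sub>-\<^sub>1\<close>.
\<close>

definition bary_monomial :: "nat \<Rightarrow> (nat \<Rightarrow> nat) \<Rightarrow> (nat \<Rightarrow> 'a::real_normed_field) \<Rightarrow> 'a" where
  "bary_monomial n m x = monomial n m (complete_point n x)"

lemma dec_commute: "dec i (dec j m) = dec j (dec i m)"
  by (auto simp: dec_def fun_eq_iff)

lemma monomial_remove:
  assumes "i \<in> {1..n}"
  shows "monomial n m y = y i ^ m i * (\<Prod>j\<in>{1..n}-{i}. y j ^ m j)"
  unfolding monomial_def using assms by (intro prod.remove) auto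

text \<open>
  The relation \<open>y\<^sub>i \<partial>(y\<^sup>m)/\<partial>y\<^sub>i = m\<^sub>i y\<^sup>m\<close>. The factor \<open>m\<^sub>i\<close> stays on both sides because for \<open>m\<^sub>i = 0\<close>
  the truncated decrement does nothing; it makes both sides vanish in that case.
\<close>

lemma monomial_dec:
  fixes y :: "nat \<Rightarrow> 'a::comm_ring_1"
  assumes "i \<in> {1..n}"
  shows "of_nat (m i) * (y i * monomial n (dec i m) y) = of_nat (m i) * monomial n m y"
proof -
  have "(\<Prod>j\<in>{1..n}-{i}. y j ^ dec i m j) = (\<Prod>j\<in>{1..n}-{i}. y j ^ m j)"
    by (intro prod.cong) (auto simp: dec_def)
  then show ?thesis
    by (cases "m i") (simp_all add: monomial_remove[OF assms] dec_def mult_ac)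
qed

lemma monomial_permute:
  assumes "\<sigma> permutes {1..n}"
  shows "monomial n m (y \<circ> \<sigma>) = monomial n (m \<circ> inv \<sigma>) y"
  using prod.permute[OF assms, of "\<lambda>j. y j ^ m (inv \<sigma> j)"] assms
  by (simp add: monomial_def o_def permutes_inverses)

lemma dec_comp_inv:
  assumes "\<sigma> permutes S"
  shows "dec (\<sigma> l) (m \<circ> inv \<sigma>) = dec l m \<circ> inv \<sigma>"
  using assms by (auto simp: dec_def fun_eq_iff permutes_inverses)

text \<open>
  Isolates the dependence on \<open>x\<^sub>i\<close>, which occurs both directly and through \<open>y\<^sub>n\<close>.
\<close>

lemma bary_monomial_split:
  assumes "i \<in> {1..n-1}"
  shows "bary_monomial n m x = x i ^ m i * (1 - (x i + (\<Sum>j\<in>{1..n-1}-{i}. x j))) ^ m n *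
    (\<Prod>j\<in>{1..n-1}-{i}. x j ^ m j)"
proof -
  have "{1..n} - {n} = {1..n-1}" "n \<in> {1..n}" using assms by auto
  then have "bary_monomial n m x = complete_point n x n ^ m n * (\<Prod>j\<in>{1..n-1}. complete_point n x j ^ m j)"
    by (simp only: bary_monomial_def monomial_remove[of n n])
  also have "(\<Prod>j\<in>{1..n-1}. complete_point n x j ^ m j) = (\<Prod>j\<in>{1..n-1}. x j ^ m j)"
    by (intro prod.cong) (auto simp: complete_point_def)
  also have "\<dots> = x i ^ m i * (\<Prod>j\<in>{1..n-1}-{i}. x j ^ m j)"
    using assms by (intro prod.remove) auto
  also have "complete_point n x n = 1 - (x i + (\<Sum>j\<in>{1..n-1}-{i}. x j))"
    using assms by (simp add: complete_point_def sum.remove[of _ i])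
  finally show ?thesis by (simp only: mult_ac)
qed

text \<open>
  By the chain rule, since \<open>y\<^sub>n\<close> has derivative \<open>-1\<close> with respect to every \<open>x\<^sub>i\<close>, the derivative
  along \<open>x\<^sub>i\<close> is the difference of the formal derivatives in \<open>y\<^sub>i\<close> and in \<open>y\<^sub>n\<close>.
\<close>

definition bary_monomial_partial ::
    "nat \<Rightarrow> nat \<Rightarrow> (nat \<Rightarrow> nat) \<Rightarrow> (nat \<Rightarrow> 'a::real_normed_field) \<Rightarrow> 'a" where
  "bary_monomial_partial n i m x =
     of_nat (m i) * bary_monomial n (dec i m) x - of_nat (m n) * bary_monomial n (dec n m) x"

lemma has_partial_bary_monomial:
  assumes "i \<in> {1..n-1}"
  shows "has_partial i (bary_monomial n m) (bary_monomial_partial n i m)"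
  unfolding has_partial_def
proof
  fix x :: "nat \<Rightarrow> 'a"
  define r where "r = (\<Sum>j\<in>{1..n-1}-{i}. x j)"
  define C where "C = (\<Prod>j\<in>{1..n-1}-{i}. x j ^ m j)"
  have ne: "i \<noteq> n" using assms by auto
  have sl: "slice i (bary_monomial n m) x = (\<lambda>t. t ^ m i * (1 - (t + r)) ^ m n * C)"
    unfolding slice_def
  proof
    fix t
    have "(\<Sum>j\<in>{1..n-1}-{i}. (x(i:=t)) j) = r" unfolding r_def by (intro sum.cong) auto
    moreover have "(\<Prod>j\<in>{1..n-1}-{i}. (x(i:=t)) j ^ m j) = C"
      unfolding C_def by (intro prod.cong) auto
    ultimately show "bary_monomial n m (x(i := t)) = t ^ m i * (1 - (t + r)) ^ m n * C"
      unfolding bary_monomial_split[OF assms] by simp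
  qed
  have C: "(\<Prod>j\<in>{1..n-1}-{i}. x j ^ dec i m j) = C" "(\<Prod>j\<in>{1..n-1}-{i}. x j ^ dec n m j) = C"
    unfolding C_def using assms by (auto simp: dec_def intro!: prod.cong split: if_splits)
  have "((\<lambda>t. t ^ m i * (1 - (t + r)) ^ m n * C) has_field_derivative
     (of_nat (m i) * (x i ^ (m i - 1) * (1 - (x i + r)) ^ m n * C)
      - of_nat (m n) * (x i ^ m i * (1 - (x i + r)) ^ (m n - 1) * C))) (at (x i))"
    by (rule derivative_eq_intros refl | simp add: algebra_simps)+
  then show "(slice i (bary_monomial n m) x has_field_derivative bary_monomial_partial n i m x) (at (x i))"
    unfolding sl bary_monomial_partial_def bary_monomial_split[OF assms] C r_def[symmetric]
    using ne by (simp add: dec_def)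
qed

lemma has_partial_bary_monomial_partial:
  assumes "j \<in> {1..n-1}"
  shows "has_partial j (bary_monomial_partial n i m)
    (\<lambda>x. of_nat (m i) * bary_monomial_partial n j (dec i m) x
       - of_nat (m n) * bary_monomial_partial n j (dec n m) x)"
  unfolding bary_monomial_partial_def[of n i m, abs_def]
  by (intro has_partial_diff_cmult has_partial_bary_monomial assms)

lemma continuous_on_bary_monomial:
  "continuous_on UNIV (bary_monomial n m :: (nat \<Rightarrow> 'a::real_normed_field) \<Rightarrow> 'a)"
proof -
  have "continuous_on UNIV (\<lambda>x::nat \<Rightarrow> 'a. complete_point n x j)" for j
  proof (cases "j = n")
    case True
    then show ?thesis
      by (auto simp: complete_point_def intro!: continuous_intros)
  next
    case False
    then show ?thesis
      by (auto simp: complete_point_def intro!: continuous_intros)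
  qed
  then show ?thesis
    unfolding bary_monomial_def[abs_def] monomial_def
    by (intro continuous_intros)
qed

lemma bary_monomial_depends: "depends_on_first (n-1) (bary_monomial n m)"
  unfolding depends_on_first_def
proof (intro allI impI)
  fix x y :: "nat \<Rightarrow> 'a"
  assume eq: "\<forall>i\<in>{1..n-1}. x i = y i"
  then have "(\<Sum>i\<in>{1..n-1}. x i) = (\<Sum>i\<in>{1..n-1}. y i)" by (intro sum.cong) auto
  then have "complete_point n x i = complete_point n y i" if "i \<in> {1..n}" for i
    using that eq by (auto simp: complete_point_def)
  then show "bary_monomial n m x = bary_monomial n m y"
    by (simp add: bary_monomial_def monomial_def)
qed

text \<open>
  Derivatives of monomials are combinations of monomials again, so smoothness and the explicit
  second derivatives of a polynomial follow from closure of \<open>has_partial\<close> under linear combinations.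
\<close>

lemma twice_cont_diff_combination:
  "twice_cont_diff (n-1) (\<lambda>x. \<Sum>s\<in>S. c s * bary_monomial n (m s) x)"
  and partial_combination: "i \<in> {1..n-1} \<Longrightarrow>
    partial i (\<lambda>x. \<Sum>s\<in>S. c s * bary_monomial n (m s) x)
      = (\<lambda>x. \<Sum>s\<in>S. c s * bary_monomial_partial n i (m s) x)"
  and partial_partial_combination: "i \<in> {1..n-1} \<Longrightarrow> j \<in> {1..n-1} \<Longrightarrow>
    partial j (partial i (\<lambda>x. \<Sum>s\<in>S. c s * bary_monomial n (m s) x))
      = (\<lambda>x. \<Sum>s\<in>S. c s * (of_nat (m s i) * bary_monomial_partial n j (dec i (m s)) x
           - of_nat (m s n) * bary_monomial_partial n j (dec n (m s)) x))"
proof -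
  let ?v = "\<lambda>x. \<Sum>s\<in>S. c s * bary_monomial n (m s) x"
  have D1: "has_partial i ?v (\<lambda>x. \<Sum>s\<in>S. c s * bary_monomial_partial n i (m s) x)"
    if "i \<in> {1..n-1}" for i
    by (intro has_partial_linear_combination has_partial_bary_monomial that)
  show p1: "partial i ?v = (\<lambda>x. \<Sum>s\<in>S. c s * bary_monomial_partial n i (m s) x)"
    if "i \<in> {1..n-1}" for i
    by (rule has_partial_partial[OF D1[OF that]])
  have D2: "has_partial j (partial i ?v)
     (\<lambda>x. \<Sum>s\<in>S. c s * (of_nat (m s i) * bary_monomial_partial n j (dec i (m s)) x
           - of_nat (m s n) * bary_monomial_partial n j (dec n (m s)) x))"
    if "i \<in> {1..n-1}" "j \<in> {1..n-1}" for i j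
    unfolding p1[OF that(1)]
    by (intro has_partial_linear_combination has_partial_bary_monomial_partial that)
  show p2: "partial j (partial i ?v) =
     (\<lambda>x. \<Sum>s\<in>S. c s * (of_nat (m s i) * bary_monomial_partial n j (dec i (m s)) x
           - of_nat (m s n) * bary_monomial_partial n j (dec n (m s)) x))"
    if "i \<in> {1..n-1}" "j \<in> {1..n-1}" for i j
    by (rule has_partial_partial[OF D2[OF that]])
  have dep: "depends_on_first (n-1) ?v"
    using bary_monomial_depends[where 'a='a] unfolding depends_on_first_def
    by (intro allI impI sum.cong refl arg_cong2[where f="(*)"]) blast
  have cont: "continuous_on UNIV ?v"
    "continuous_on UNIV (\<lambda>x. \<Sum>s\<in>S. c s * bary_monomial_partial n i (m s) x)"
    "continuous_on UNIV (\<lambda>x. \<Sum>s\<in>S. c s * (of_nat (m s i) * bary_monomial_partial n j (dec i (m s)) x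
           - of_nat (m s n) * bary_monomial_partial n j (dec n (m s)) x))" for i j
    unfolding bary_monomial_partial_def
    by (intro continuous_intros continuous_on_bary_monomial)+
  show "twice_cont_diff (n-1) ?v"
    unfolding twice_cont_diff_def
    using dep cont(1) cont(2) cont(3) p1 p2
      has_partial_pderiv_ex[OF D1] has_partial_pderiv_ex[OF D2] by auto
qed

section \<open>The differential operator in barycentric form\<close>

text \<open>
  The left-hand side of the equation with the second and first derivatives replaced by
  arbitrary arrays \<open>W\<close> and \<open>D\<close>. This separates the algebra of the operator from the calculus.
\<close>

definition pde_form ::
  "nat \<Rightarrow> (nat \<Rightarrow> nat) \<Rightarrow> (nat \<Rightarrow> 'a::comm_ring_1) \<Rightarrow> (nat \<Rightarrow> nat \<Rightarrow> 'a) \<Rightarrow> (nat \<Rightarrow> 'a) \<Rightarrow> 'a" where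
  "pde_form n a x W D =
     (\<Sum>i\<in>{1..n-1}. x i * (1 - x i) * W i i)
     - 2 * (\<Sum>i\<in>{1..n-1}. \<Sum>j\<in>{i<..n-1}. x i * x j * W i j)
     + (\<Sum>i\<in>{1..n-1}. (of_nat (\<Sum>l\<in>{1..n}. a l) * x i - of_nat (a i)) * D i)"

lemma pde_form_cong:
  assumes "\<And>i j. i \<in> {1..n-1} \<Longrightarrow> j \<in> {1..n-1} \<Longrightarrow> W i j = W' i j"
    and "\<And>i. i \<in> {1..n-1} \<Longrightarrow> D i = D' i"
  shows "pde_form n a x W D = pde_form n a x W' D'"
  unfolding pde_form_def using assms by (intro arg_cong2[where f="(+)"] arg_cong2[where f="(-)"]
    arg_cong2[where f="(*)"] sum.cong refl) auto

lemma pde_form_linear: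
  "pde_form n a x (\<lambda>i j. \<Sum>s\<in>S. c s * W s i j) (\<lambda>i. \<Sum>s\<in>S. c s * D s i)
     = (\<Sum>s\<in>S. c s * pde_form n a x (W s) (D s))"
proof (induction S rule: infinite_finite_induct)
  case (insert t S)
  have "pde_form n a x (\<lambda>i j. c t * W t i j + (\<Sum>s\<in>S. c s * W s i j))
      (\<lambda>i. c t * D t i + (\<Sum>s\<in>S. c s * D s i))
    = c t * pde_form n a x (W t) (D t) +
      pde_form n a x (\<lambda>i j. \<Sum>s\<in>S. c s * W s i j) (\<lambda>i. \<Sum>s\<in>S. c s * D s i)"
    unfolding pde_form_def
    by (simp only: distrib_left sum.distrib sum_distrib_left right_diff_distrib mult_ac)
       (simp add: algebra_simps)
  then show ?case using insert by simp
qed (simp_all add: pde_form_def)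

lemma symmetric_double_sum:
  fixes g :: "nat \<Rightarrow> nat \<Rightarrow> 'a::comm_ring_1"
  assumes "\<And>i j. g i j = g j i"
  shows "(\<Sum>i\<in>{1..N}. \<Sum>j\<in>{1..N}. g i j)
    = (\<Sum>i\<in>{1..N}. g i i) + 2 * (\<Sum>i\<in>{1..N}. \<Sum>j\<in>{i<..N}. g i j)"
proof (induction N)
  case (Suc N)
  have "(\<Sum>j\<in>{i<..Suc N}. g i j) = (\<Sum>j\<in>{i<..N}. g i j) + g i (Suc N)" if "i \<in> {1..N}" for i
  proof -
    have "{i<..Suc N} = insert (Suc N) {i<..N}" using that by auto
    then show ?thesis by (simp add: add.commute)
  qed
  then have "(\<Sum>i\<in>{1..N}. \<Sum>j\<in>{i<..Suc N}. g i j)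
      = (\<Sum>i\<in>{1..N}. \<Sum>j\<in>{i<..N}. g i j) + (\<Sum>i\<in>{1..N}. g i (Suc N))"
    by (simp add: sum.distrib)
  moreover have "(\<Sum>j\<in>{1..N}. g (Suc N) j) = (\<Sum>j\<in>{1..N}. g j (Suc N))"
    using assms by (intro sum.cong) auto
  ultimately show ?case
    using Suc by (simp add: sum.distrib algebra_simps)
qed simp

text \<open>
  The second-order part is the quadratic form \<open>\<Sum>\<^sub>i y\<^sub>i \<xi>\<^sub>i\<^sup>2 - (\<Sum>\<^sub>i y\<^sub>i \<xi>\<^sub>i)\<^sup>2\<close>, a variance with respect
  to the weights \<open>y\<^sub>i\<close>, and is therefore invariant under adding the same constant to all \<open>\<xi>\<^sub>i\<close>. The
  first-order part has this invariance because \<open>\<Sum>\<^sub>i (A y\<^sub>i - a\<^sub>i) = 0\<close>. So \<open>\<xi>\<^sub>i\<close> may be replaced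
  by \<open>\<xi>\<^sub>i - \<xi>\<^sub>n\<close>, which eliminates the last variable. In the statement \<open>V\<close> and \<open>G\<close> stand for the
  second and first derivatives of a function of all \<open>n\<close> variables.
\<close>

lemma pde_form_barycentric:
  fixes y :: "nat \<Rightarrow> 'a::comm_ring_1"
  assumes "n \<ge> 1" and yn: "y n = 1 - (\<Sum>i\<in>{1..n-1}. y i)"
    and sym: "\<And>i j. V i j = V j i"
  shows "pde_form n a y (\<lambda>i j. V i j - V i n - V n j + V n n) (\<lambda>i. G i - G n)
    = (\<Sum>i\<in>{1..n}. y i * V i i) - (\<Sum>i\<in>{1..n}. \<Sum>j\<in>{1..n}. y i * y j * V i j)
      + (\<Sum>i\<in>{1..n}. (of_nat (\<Sum>l\<in>{1..n}. a l) * y i - of_nat (a i)) * G i)"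
proof -
  let ?I = "{1..n-1}"
  define A :: 'a where "A = of_nat (\<Sum>l\<in>{1..n}. a l)"
  define P where "P = (\<Sum>i\<in>?I. y i)"
  define Q where "Q = (\<Sum>i\<in>?I. y i * V i n)"
  define T where "T = (\<Sum>i\<in>?I. y i * V i i)"
  define U where "U = (\<Sum>i\<in>?I. \<Sum>j\<in>?I. y i * y j * V i j)"
  define H where "H = (\<Sum>i\<in>?I. (A * y i - of_nat (a i)) * G i)"
  have In: "{1..n} = insert n ?I" "n \<notin> ?I" using assms(1) by auto
  have top: "sum h {1..n} = h n + sum h ?I" for h :: "nat \<Rightarrow> 'a"
    unfolding In(1) using In(2) by simp
  let ?W = "\<lambda>i j. V i j - V i n - V n j + V n n"
  have WS: "?W i j = ?W j i" for i j using sym[of i j] sym[of i n] sym[of n j] by simp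
  \<comment> \<open>completing the sum over \<open>i < j\<close> and the diagonal terms \<open>- y\<^sub>i\<^sup>2 W\<^sub>i\<^sub>i\<close> to a full double sum\<close>
  have "(\<Sum>i\<in>?I. \<Sum>j\<in>?I. y i * y j * ?W i j) =
      (\<Sum>i\<in>?I. y i * y i * ?W i i) + 2 * (\<Sum>i\<in>?I. \<Sum>j\<in>{i<..n-1}. y i * y j * ?W i j)"
    by (rule symmetric_double_sum) (simp add: WS[symmetric] mult.commute)
  then have second: "(\<Sum>i\<in>?I. y i * (1 - y i) * ?W i i)
      - 2 * (\<Sum>i\<in>?I. \<Sum>j\<in>{i<..n-1}. y i * y j * ?W i j)
      = (\<Sum>i\<in>?I. y i * ?W i i) - (\<Sum>i\<in>?I. \<Sum>j\<in>?I. y i * y j * ?W i j)"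
    by (simp add: right_diff_distrib left_diff_distrib sum_subtractf)
  have W1: "(\<Sum>i\<in>?I. y i * ?W i i) = T - 2 * Q + P * V n n"
  proof -
    have "y i * ?W i i = y i * V i i - 2 * (y i * V i n) + y i * V n n" for i
      unfolding sym[of n i] by (simp add: algebra_simps)
    then show ?thesis
      by (simp only: sum.distrib sum_subtractf sum_distrib_left[symmetric] sum_distrib_right[symmetric]
          T_def Q_def P_def)
  qed
  have W2: "(\<Sum>i\<in>?I. \<Sum>j\<in>?I. y i * y j * ?W i j) = U - 2 * P * Q + P * P * V n n"
  proof -
    have "y i * y j * ?W i j =
        y i * y j * V i j - (y i * V i n) * y j - y i * (y j * V j n) + (y i * y j) * V n n" for i j
      unfolding sym[of n j] by (simp add: algebra_simps)
    then have "(\<Sum>i\<in>?I. \<Sum>j\<in>?I. y i * y j * ?W i j) = U - Q * P - P * Q + P * P * V n n"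
      by (simp only: sum.distrib sum_subtractf sum_distrib_left[symmetric] sum_distrib_right[symmetric]
          U_def Q_def P_def)
    then show ?thesis by (simp add: algebra_simps)
  qed
  have D: "(\<Sum>i\<in>?I. (A * y i - of_nat (a i)) * (G i - G n)) = H + (A * y n - of_nat (a n)) * G n"
  proof -
    have A: "(\<Sum>i\<in>?I. of_nat (a i)) = A - of_nat (a n)"
      using top[of "\<lambda>i. of_nat (a i)"] by (simp add: A_def)
    have "(\<Sum>i\<in>?I. (A * y i - of_nat (a i)) * (G i - G n)) =
        H - (A * P - (\<Sum>i\<in>?I. of_nat (a i))) * G n"
      by (simp add: H_def P_def right_diff_distrib sum_subtractf left_diff_distrib
          sum_distrib_left sum_distrib_right)
    also have "\<dots> = H + (A * y n - of_nat (a n)) * G n"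
      unfolding yn P_def[symmetric] A by (simp add: algebra_simps)
    finally show ?thesis .
  qed
  have R2: "(\<Sum>i\<in>{1..n}. \<Sum>j\<in>{1..n}. y i * y j * V i j) =
      y n * y n * V n n + 2 * y n * Q + U"
  proof -
    have "(\<Sum>j\<in>?I. y n * y j * V n j) = y n * Q" "(\<Sum>i\<in>?I. y i * y n * V i n) = y n * Q"
      unfolding Q_def sum_distrib_left using sym[of n] by (auto intro!: sum.cong simp: mult_ac)
    then show ?thesis
      unfolding top by (simp add: sum.distrib U_def algebra_simps)
  qed
  have "pde_form n a y ?W (\<lambda>i. G i - G n) =
      (T - 2 * Q + P * V n n) - (U - 2 * P * Q + P * P * V n n) + (H + (A * y n - of_nat (a n)) * G n)"
    unfolding pde_form_def second W1 W2 A_def[symmetric] D ..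
  also have "\<dots> = (y n * V n n + T) - (y n * y n * V n n + 2 * y n * Q + U)
      + ((A * y n - of_nat (a n)) * G n + H)"
    unfolding yn P_def[symmetric] by (simp add: algebra_simps)
  also have "\<dots> = (\<Sum>i\<in>{1..n}. y i * V i i) - (\<Sum>i\<in>{1..n}. \<Sum>j\<in>{1..n}. y i * y j * V i j)
      + (\<Sum>i\<in>{1..n}. (A * y i - of_nat (a i)) * G i)"
    unfolding R2 by (simp only: top T_def H_def)
  finally show ?thesis unfolding A_def .
qed

text \<open>
  With \<open>V\<close> and \<open>G\<close> the formal derivatives of \<open>y\<^sup>m\<close> in \<open>n\<close> variables, Euler's identities
  \<open>\<Sum>\<^sub>i y\<^sub>i \<partial>\<^sub>i y\<^sup>m = K y\<^sup>m\<close> and \<open>\<Sum>\<^sub>i\<^sub>,\<^sub>j y\<^sub>i y\<^sub>j \<partial>\<^sub>i \<partial>\<^sub>j y\<^sup>m = K (K - 1) y\<^sup>m\<close> evaluate the barycentric form.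
\<close>

lemma pde_form_bary_monomial:
  fixes x :: "nat \<Rightarrow> 'a::real_normed_field" and m a :: "nat \<Rightarrow> nat"
  assumes "n \<ge> 1"
  defines "K \<equiv> (\<Sum>i\<in>{1..n}. m i)" and "A \<equiv> (\<Sum>i\<in>{1..n}. a i)"
  shows "pde_form n a x
      (\<lambda>i j. of_nat (m j) * bary_monomial_partial n i (dec j m) x
           - of_nat (m n) * bary_monomial_partial n i (dec n m) x)
      (\<lambda>i. bary_monomial_partial n i m x)
    = (\<Sum>i\<in>{1..n}. of_nat (m i) * (of_nat (m i) - 1 - of_nat (a i)) * bary_monomial n (dec i m) x)
      - of_nat K * (of_nat K - 1 - of_nat A) * bary_monomial n m x"
proof -
  define y where "y = complete_point n x"
  define N where "N = (\<lambda>m. monomial n m y)"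
  have BN: "bary_monomial n m x = N m" for m by (simp add: bary_monomial_def N_def y_def)
  define G where "G = (\<lambda>i. of_nat (m i) * N (dec i m))"
  define V where "V = (\<lambda>i j. of_nat (m i) * (of_nat (dec i m j) * N (dec j (dec i m))))"
  have yx: "y i = x i" if "i \<in> {1..n-1}" for i using that by (auto simp: y_def complete_point_def)
  have yn: "y n = 1 - (\<Sum>i\<in>{1..n-1}. y i)"
  proof -
    have "(\<Sum>i\<in>{1..n-1}. y i) = (\<Sum>i\<in>{1..n-1}. x i)" by (intro sum.cong yx) auto
    then show ?thesis by (simp add: y_def complete_point_def)
  qed
  have Vsym: "V i j = V j i" for i j
    by (cases "i = j") (simp_all add: V_def dec_commute[of i j], simp add: dec_def)
  have G: "y i * G i = of_nat (m i) * N m" if "i \<in> {1..n}" for i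
    using monomial_dec[OF that, of m y] by (simp add: G_def N_def mult_ac)
  have V: "y j * V i j = of_nat (dec i m j) * G i" if "j \<in> {1..n}" for i j
    using monomial_dec[OF that, of "dec i m" y]
    by (simp add: V_def G_def N_def mult_ac)
  have Vd: "y i * V i i = of_nat (m i) * (of_nat (m i) - 1) * N (dec i m)" if "i \<in> {1..n}" for i
    unfolding V[OF that] by (cases "m i") (simp_all add: G_def dec_def)
  have double: "(\<Sum>i\<in>{1..n}. \<Sum>j\<in>{1..n}. y i * y j * V i j) = of_nat K * (of_nat K - 1) * N m"
  proof -
    have "(\<Sum>j\<in>{1..n}. y i * y j * V i j) = of_nat (m i) * (of_nat K - 1) * N m"
      if i: "i \<in> {1..n}" for i
    proof -
      have "(\<Sum>j\<in>{1..n}. y i * y j * V i j) = (\<Sum>j\<in>{1..n}. of_nat (dec i m j) * (of_nat (m i) * N m))"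
        by (intro sum.cong refl) (metis V G[OF i] mult.assoc mult.left_commute)
      also have "\<dots> = of_nat (\<Sum>j\<in>{1..n}. dec i m j) * (of_nat (m i) * N m)"
        by (simp add: sum_distrib_right)
      also have "(\<Sum>j\<in>{1..n}. dec i m j) = m i - 1 + (\<Sum>j\<in>{1..n}-{i}. m j)"
        using i by (subst sum.remove[of _ i]) (auto simp: dec_def intro!: sum.cong)
      also have "K = m i + (\<Sum>j\<in>{1..n}-{i}. m j)"
        unfolding K_def using i by (subst sum.remove[of _ i]) auto
      then have "of_nat (m i - 1 + (\<Sum>j\<in>{1..n}-{i}. m j)) * (of_nat (m i) * N m)
          = of_nat (m i) * (of_nat K - 1) * N m"
        by (cases "m i") (simp_all add: algebra_simps)
      finally show ?thesis .
    qed
    then have "(\<Sum>i\<in>{1..n}. \<Sum>j\<in>{1..n}. y i * y j * V i j)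
        = (\<Sum>i\<in>{1..n}. of_nat (m i) * ((of_nat K - 1) * N m))"
      by (intro sum.cong) (auto simp: mult.assoc)
    then show ?thesis by (simp add: K_def sum_distrib_right mult.assoc)
  qed
  have first: "(\<Sum>i\<in>{1..n}. (of_nat A * y i - of_nat (a i)) * G i)
      = of_nat A * of_nat K * N m - (\<Sum>i\<in>{1..n}. of_nat (a i) * (of_nat (m i) * N (dec i m)))"
  proof -
    have "(\<Sum>i\<in>{1..n}. (of_nat A * y i - of_nat (a i)) * G i)
      = (\<Sum>i\<in>{1..n}. of_nat (m i) * (of_nat A * N m) - of_nat (a i) * (of_nat (m i) * N (dec i m)))"
    proof (intro sum.cong refl)
      fix i assume "i \<in> {1..n}"
      have "(of_nat A * y i - of_nat (a i)) * G i = of_nat A * (y i * G i) - of_nat (a i) * G i"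
        by (simp add: algebra_simps)
      then show "(of_nat A * y i - of_nat (a i)) * G i
        = of_nat (m i) * (of_nat A * N m) - of_nat (a i) * (of_nat (m i) * N (dec i m))"
        unfolding G[OF \<open>i \<in> {1..n}\<close>] by (simp add: G_def mult_ac)
    qed
    then show ?thesis by (simp add: sum_subtractf K_def sum_distrib_left sum_distrib_right mult_ac)
  qed
  have "pde_form n a x
      (\<lambda>i j. of_nat (m j) * bary_monomial_partial n i (dec j m) x
           - of_nat (m n) * bary_monomial_partial n i (dec n m) x)
      (\<lambda>i. bary_monomial_partial n i m x)
    = pde_form n a y (\<lambda>i j. V i j - V i n - V n j + V n n) (\<lambda>i. G i - G n)"
  proof -
    have "of_nat (m j) * bary_monomial_partial n i (dec j m) x
           - of_nat (m n) * bary_monomial_partial n i (dec n m) x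
        = V i j - V i n - V n j + V n n" for i j
      unfolding Vsym[of i j] Vsym[of i n] Vsym[of n j]
      by (simp add: bary_monomial_partial_def BN V_def algebra_simps)
    moreover have "bary_monomial_partial n i m x = G i - G n" for i
      by (simp add: bary_monomial_partial_def BN G_def)
    ultimately have "pde_form n a x
      (\<lambda>i j. of_nat (m j) * bary_monomial_partial n i (dec j m) x
           - of_nat (m n) * bary_monomial_partial n i (dec n m) x)
      (\<lambda>i. bary_monomial_partial n i m x)
      = pde_form n a x (\<lambda>i j. V i j - V i n - V n j + V n n) (\<lambda>i. G i - G n)"
      by simp
    also have "\<dots> = pde_form n a y (\<lambda>i j. V i j - V i n - V n j + V n n) (\<lambda>i. G i - G n)"
      unfolding pde_form_def using yx
      by (intro arg_cong2[where f="(+)"] arg_cong2[where f="(-)"]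
          arg_cong2[where f="(*)"] sum.cong refl) auto
    finally show ?thesis .
  qed
  also have "\<dots> = (\<Sum>i\<in>{1..n}. of_nat (m i) * (of_nat (m i) - 1) * N (dec i m))
      - of_nat K * (of_nat K - 1) * N m
      + (of_nat A * of_nat K * N m - (\<Sum>i\<in>{1..n}. of_nat (a i) * (of_nat (m i) * N (dec i m))))"
  proof -
    have "(\<Sum>i\<in>{1..n}. y i * V i i) = (\<Sum>i\<in>{1..n}. of_nat (m i) * (of_nat (m i) - 1) * N (dec i m))"
      by (intro sum.cong Vd) auto
    then show ?thesis
      by (simp only: pde_form_barycentric[where V=V and G=G, OF assms(1) yn Vsym] double first[unfolded A_def] A_def)
  qed
  also have "\<dots> = (\<Sum>i\<in>{1..n}. of_nat (m i) * (of_nat (m i) - 1 - of_nat (a i)) * N (dec i m))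
      - of_nat K * (of_nat K - 1 - of_nat A) * N m"
    by (simp add: algebra_simps sum_subtractf sum.distrib)
  finally show ?thesis unfolding BN .
qed

section \<open>Comparison of coefficients\<close>

text \<open>
  Induction on the number of variables: fixing all but one of them leaves a polynomial in
  one variable with infinitely many roots, and its coefficients, which must vanish, are
  polynomials in the remaining variables.
\<close>

lemma multivariate_coefficients_zero:
  fixes S :: "'a::{idom,real_normed_div_algebra} set" and \<delta> :: "(nat \<Rightarrow> nat) \<Rightarrow> 'a"
  assumes "finite I" "infinite S"
    and "\<forall>y. (\<forall>i\<in>I. y i \<in> S) \<longrightarrow>
           (\<Sum>k\<in>(\<Pi>\<^sub>E i\<in>I. {0..b i}). \<delta> k * (\<Prod>i\<in>I. y i ^ k i)) = 0"
  shows "\<forall>k\<in>(\<Pi>\<^sub>E i\<in>I. {0..b i}). \<delta> k = 0"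
  using assms(1,3)
proof (induction I arbitrary: \<delta> rule: finite_induct)
  case empty
  then show ?case by simp
next
  case (insert j I)
  let ?B = "\<Pi>\<^sub>E i\<in>I. {0..b i}"
  show ?case
  proof
    fix k assume "k \<in> (\<Pi>\<^sub>E i\<in>insert j I. {0..b i})"
    then obtain c k' where k: "k = k'(j := c)" "c \<le> b j" "k' \<in> ?B"
      by (auto simp: PiE_insert_eq)
    have slices: "(\<Sum>k\<in>?B. \<delta> (k(j := c)) * (\<Prod>i\<in>I. y i ^ k i)) = 0"
      if y: "\<forall>i\<in>I. y i \<in> S" for y
    proof -
      \<comment> \<open>coefficients of the polynomial with respect to the variable \<open>j\<close>, the others fixed as in \<open>y\<close>\<close>
      define q where "q = (\<lambda>c. \<Sum>k\<in>?B. \<delta> (k(j := c)) * (\<Prod>i\<in>I. y i ^ k i))"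
      have "(\<Sum>c\<le>b j. q c * t ^ c) = 0" if t: "t \<in> S" for t
      proof -
        have "(\<Sum>k\<in>(\<Pi>\<^sub>E i\<in>insert j I. {0..b i}). \<delta> k * (\<Prod>i\<in>insert j I. (y(j := t)) i ^ k i)) = 0"
          by (rule insert.prems[rule_format]) (use y t in auto)
        also have "(\<Sum>k\<in>(\<Pi>\<^sub>E i\<in>insert j I. {0..b i}). \<delta> k * (\<Prod>i\<in>insert j I. (y(j := t)) i ^ k i))
          = (\<Sum>(c, k)\<in>{0..b j} \<times> ?B. \<delta> (k(j := c)) * (\<Prod>i\<in>insert j I. (y(j := t)) i ^ (k(j := c)) i))"
          unfolding PiE_insert_eq
          by (subst sum.reindex[OF inj_combinator[OF insert.hyps(2)]])
             (simp add: o_def case_prod_unfold)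
        also have "\<dots> = (\<Sum>(c, k)\<in>{0..b j} \<times> ?B. \<delta> (k(j := c)) * (\<Prod>i\<in>I. y i ^ k i) * t ^ c)"
        proof (intro sum.cong refl, clarify)
          fix c k
          have "(\<Prod>i\<in>I. (y(j := t)) i ^ (k(j := c)) i) = (\<Prod>i\<in>I. y i ^ k i)"
            using insert.hyps(2) by (intro prod.cong) auto
          then show "\<delta> (k(j := c)) * (\<Prod>i\<in>insert j I. (y(j := t)) i ^ (k(j := c)) i)
            = \<delta> (k(j := c)) * (\<Prod>i\<in>I. y i ^ k i) * t ^ c"
            using insert.hyps by (simp add: mult_ac)
        qed
        also have "\<dots> = (\<Sum>c\<le>b j. q c * t ^ c)"
          by (simp add: sum.cartesian_product[symmetric] q_def sum_distrib_right atLeast0AtMost)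
        finally show ?thesis .
      qed
      then have "S \<subseteq> {t. (\<Sum>c\<le>b j. q c * t ^ c) = 0}" by auto
      then have "infinite {t. (\<Sum>c\<le>b j. q c * t ^ c) = 0}"
        using \<open>infinite S\<close> finite_subset by blast
      then have "q c = 0"
        using k(2) polyfun_finite_roots[of q "b j"] by auto
      then show ?thesis by (simp add: q_def)
    qed
    then have "\<forall>k\<in>?B. \<delta> (k(j := c)) = 0"
      by (intro insert.IH[of "\<lambda>k. \<delta> (k(j := c))"]) blast
    then show "\<delta> k = 0"
      using k by simp
  qed
qed

section \<open>The operator on coefficients\<close>

text \<open>
  The action of the differential operator on the coefficients of \<open>f_form\<close>. The number
  \<open>b\<^sub>n + 1 + \<Sum>\<^sub>i k\<^sub>i\<close> is the total degree of the monomial with index \<open>k\<close>, including the power of \<open>y\<^sub>n\<close>.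
\<close>

definition recurrence ::
    "nat \<Rightarrow> (nat \<Rightarrow> nat) \<Rightarrow> ((nat \<Rightarrow> nat) \<Rightarrow> 'a) \<Rightarrow> (nat \<Rightarrow> nat) \<Rightarrow> 'a::comm_ring_1" where
  "recurrence n b \<gamma> k = (\<Sum>l\<in>{1..n-1}. (of_nat (k l) - of_nat (b l)) *
     (of_nat (Suc (k l)) * \<gamma> (k(l := Suc (k l)))
      - of_nat (b n + 1 + (\<Sum>i\<in>{1..n-1}. k i)) * \<gamma> k))"

lemma finite_multi_indices [simp]: "finite (multi_indices n b)"
  by (simp add: multi_indices_def finite_PiE)

lemma multi_indices_le: "k \<in> multi_indices n b \<Longrightarrow> l \<in> {1..n-1} \<Longrightarrow> k l \<le> b l"
  unfolding multi_indices_def by (drule PiE_mem[of _ _ _ l]) auto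

lemma multi_indices_upd:
  "k \<in> multi_indices n b \<Longrightarrow> l \<in> {1..n-1} \<Longrightarrow> c \<le> b l \<Longrightarrow> k(l := c) \<in> multi_indices n b"
  by (auto simp: multi_indices_def PiE_def extensional_def)

text \<open>
  The operator lowers exponents, so its coefficient at \<open>k\<close> involves \<open>\<gamma>\<close> at \<open>k + e\<^sub>l\<close>. The shift stays
  inside the box of indices without boundary terms: \<open>k\<^sub>l = 0\<close> is annihilated by the factor \<open>k\<^sub>l\<close> on
  the left, and \<open>k\<^sub>l = b\<^sub>l\<close> by the factor \<open>k\<^sub>l - b\<^sub>l\<close> on the right.
\<close>

lemma sum_shift_index:
  fixes \<gamma> h :: "(nat \<Rightarrow> nat) \<Rightarrow> 'a::comm_ring_1"
  assumes l: "l \<in> {1..n-1}"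
  shows "(\<Sum>k\<in>multi_indices n b. \<gamma> k * (of_nat (k l) * (of_nat (k l) - 1 - of_nat (b l)) * h (dec l k)))
    = (\<Sum>k\<in>multi_indices n b. (of_nat (k l) - of_nat (b l)) *
         (of_nat (Suc (k l)) * \<gamma> (k(l := Suc (k l)))) * h k)"
    (is "sum ?f ?B = sum ?g ?B")
proof -
  have "sum ?f ?B = sum ?f {k\<in>?B. 0 < k l}"
    by (intro sum.mono_neutral_right) auto
  also have "\<dots> = sum ?g {k\<in>?B. k l < b l}"
  proof (rule sum.reindex_bij_witness[where i = "\<lambda>k. k(l := Suc (k l))" and j = "dec l"])
    fix k assume "k \<in> {k\<in>?B. 0 < k l}"
    then have k: "k \<in> ?B" "0 < k l" "k l \<le> b l" using multi_indices_le l by auto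
    show "(dec l k)(l := Suc (dec l k l)) = k" using k by (auto simp: dec_def)
    show "dec l k \<in> {k\<in>?B. k l < b l}"
      using k multi_indices_upd[OF k(1) l, of "k l - 1"] by (auto simp: dec_def)
    show "?g (dec l k) = ?f k"
      using k by (cases "k l") (auto simp: dec_def mult_ac fun_upd_idem)
  next
    fix k assume "k \<in> {k\<in>?B. k l < b l}"
    then have k: "k \<in> ?B" "k l < b l" by auto
    show "dec l (k(l := Suc (k l))) = k" by (auto simp: dec_def)
    show "k(l := Suc (k l)) \<in> {k\<in>?B. 0 < k l}"
      using multi_indices_upd[OF k(1) l, of "Suc (k l)"] k by auto
  qed
  also have "\<dots> = sum ?g ?B"
  proof (intro sum.mono_neutral_left ballI)
    fix k assume "k \<in> ?B - {k\<in>?B. k l < b l}"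
    then have "k l = b l" using multi_indices_le[of k n b l] l by auto
    then show "?g k = 0" by simp
  qed auto
  finally show ?thesis .
qed

lemma f_form_monomial:
  assumes "n \<ge> 1"
  shows "f_form n b \<gamma> y = (\<Sum>k\<in>multi_indices n b. \<gamma> k * monomial n (k(n := b n + 1)) y)"
proof -
  have "monomial n (k(n := b n + 1)) y = y n ^ (b n + 1) * (\<Prod>i\<in>{1..n-1}. y i ^ k i)" for k
  proof -
    have "{1..n} - {n} = {1..n-1}" using assms by auto
    moreover have "(\<Prod>i\<in>{1..n-1}. y i ^ (k(n := b n + 1)) i) = (\<Prod>i\<in>{1..n-1}. y i ^ k i)"
      by (intro prod.cong) auto
    ultimately show ?thesis
      using assms by (simp add: monomial_remove[of n n])
  qed
  then show ?thesis
    by (simp add: f_form_def sum_distrib_left mult_ac)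
qed

lemma f_form_linear:
  "f_form n b (\<lambda>k. \<gamma> k - c * \<gamma>' k) y = f_form n b \<gamma> y - c * f_form n b \<gamma>' y"
  by (simp add: f_form_def algebra_simps sum_subtractf sum_distrib_left)

text \<open>
  The permutation is moved from the point to the exponents by \<open>monomial_permute\<close>; the sums over all
  \<open>n\<close> barycentric indices in \<open>pde_form_bary_monomial\<close> are then relabelled by \<open>\<sigma>\<close>. The index \<open>l = n\<close>
  drops out because \<open>(b\<^sub>n + 1) - 1 - b\<^sub>n = 0\<close>, and the degree factor \<open>K - 1 - A\<close> equals
  \<open>\<Sum>\<^sub>l (k\<^sub>l - b\<^sub>l)\<close>, so that both parts carry the common factors \<open>k\<^sub>l - b\<^sub>l\<close>.
\<close>

lemma pde_operator_f_form:
  fixes a \<sigma> :: "nat \<Rightarrow> nat" and \<gamma> :: "(nat \<Rightarrow> nat) \<Rightarrow> 'a::real_normed_field"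
  assumes "n \<ge> 1" and \<sigma>: "\<sigma> permutes {1..n}"
  defines "b \<equiv> a \<circ> \<sigma>" and "v \<equiv> (\<lambda>x. f_form n (a \<circ> \<sigma>) \<gamma> (complete_point n x \<circ> \<sigma>))"
  shows "twice_cont_diff (n-1) v"
    and "pde_form n a x (\<lambda>i j. partial i (partial j v) x) (\<lambda>i. partial i v x)
      = f_form n b (recurrence n b \<gamma>) (complete_point n x \<circ> \<sigma>)"
proof -
  define e where "e = (\<lambda>k::nat \<Rightarrow> nat. k(n := b n + 1))"
  define m where "m = (\<lambda>k. e k \<circ> inv \<sigma>)"
  define y where "y = complete_point n x \<circ> \<sigma>"
  let ?B = "multi_indices n b" and ?I = "{1..n-1}"
  have v: "v = (\<lambda>x. \<Sum>k\<in>?B. \<gamma> k * bary_monomial n (m k) x)"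
    by (simp add: v_def f_form_monomial[OF assms(1)] monomial_permute[OF \<sigma>] bary_monomial_def
        m_def e_def b_def)
  show "twice_cont_diff (n-1) v"
    unfolding v by (rule twice_cont_diff_combination)
  have single: "(\<Sum>i\<in>{1..n}. of_nat (m k i) * (of_nat (m k i) - 1 - of_nat (a i)) * bary_monomial n (dec i (m k)) x)
      - of_nat (\<Sum>i\<in>{1..n}. m k i) * (of_nat (\<Sum>i\<in>{1..n}. m k i) - 1 - of_nat (\<Sum>i\<in>{1..n}. a i)) * bary_monomial n (m k) x
      = (\<Sum>l\<in>?I. of_nat (k l) * (of_nat (k l) - 1 - of_nat (b l)) * monomial n (e (dec l k)) y)
        - (\<Sum>l\<in>?I. (of_nat (k l) - of_nat (b l)) * of_nat (b n + 1 + (\<Sum>i\<in>?I. k i)) * monomial n (e k) y)" for k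
  proof -
    have In: "{1..n} = insert n ?I" "n \<notin> ?I" using assms(1) by auto
    have "(\<Sum>i\<in>{1..n}. of_nat (m k i) * (of_nat (m k i) - 1 - of_nat (a i)) * bary_monomial n (dec i (m k)) x)
      = (\<Sum>l\<in>{1..n}. of_nat (m k (\<sigma> l)) * (of_nat (m k (\<sigma> l)) - 1 - of_nat (a (\<sigma> l))) * bary_monomial n (dec (\<sigma> l) (m k)) x)"
      by (subst sum.permute[OF \<sigma>]) (simp add: o_def)
    also have "\<dots> = (\<Sum>l\<in>{1..n}. of_nat (e k l) * (of_nat (e k l) - 1 - of_nat (b l)) * monomial n (dec l (e k)) y)"
      by (simp add: m_def dec_comp_inv[OF \<sigma>] bary_monomial_def monomial_permute[OF \<sigma>] y_def b_def
          permutes_inverses[OF \<sigma>])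
    also have "\<dots> = (\<Sum>l\<in>?I. of_nat (e k l) * (of_nat (e k l) - 1 - of_nat (b l)) * monomial n (dec l (e k)) y)"
      unfolding In(1) using In(2) by (simp add: e_def)
    also have "\<dots> = (\<Sum>l\<in>?I. of_nat (k l) * (of_nat (k l) - 1 - of_nat (b l)) * monomial n (e (dec l k)) y)"
    proof (intro sum.cong refl)
      fix l assume "l \<in> ?I"
      then have "l \<noteq> n" by auto
      then have "e k l = k l" "dec l (e k) = e (dec l k)" by (auto simp: e_def dec_def fun_eq_iff)
      then show "of_nat (e k l) * (of_nat (e k l) - 1 - of_nat (b l)) * monomial n (dec l (e k)) y
        = of_nat (k l) * (of_nat (k l) - 1 - of_nat (b l)) * monomial n (e (dec l k)) y" by simp
    qed
    finally have A: "(\<Sum>i\<in>{1..n}. of_nat (m k i) * (of_nat (m k i) - 1 - of_nat (a i)) * bary_monomial n (dec i (m k)) x)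
      = (\<Sum>l\<in>?I. of_nat (k l) * (of_nat (k l) - 1 - of_nat (b l)) * monomial n (e (dec l k)) y)" .
    have "(\<Sum>i\<in>{1..n}. m k i) = (\<Sum>l\<in>{1..n}. e k l)"
      by (subst sum.permute[OF \<sigma>]) (simp add: o_def m_def permutes_inverses[OF \<sigma>])
    also have "\<dots> = b n + 1 + (\<Sum>i\<in>?I. k i)"
    proof -
      have "(\<Sum>l\<in>?I. e k l) = (\<Sum>l\<in>?I. k l)" by (intro sum.cong) (auto simp: e_def)
      then show ?thesis unfolding In(1) using In(2) by (simp add: e_def)
    qed
    finally have K: "(\<Sum>i\<in>{1..n}. m k i) = b n + 1 + (\<Sum>i\<in>?I. k i)" .
    have "(\<Sum>i\<in>{1..n}. a i) = (\<Sum>l\<in>{1..n}. b l)"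
      by (subst sum.permute[OF \<sigma>]) (simp add: b_def)
    also have "\<dots> = b n + (\<Sum>l\<in>?I. b l)" unfolding In(1) using In(2) by simp
    finally have "(of_nat (b n + 1 + (\<Sum>i\<in>?I. k i)) - 1 - of_nat (\<Sum>i\<in>{1..n}. a i) :: 'a)
        = (\<Sum>l\<in>?I. of_nat (k l) - of_nat (b l))"
      by (simp add: sum_subtractf)
    moreover have "bary_monomial n (m k) x = monomial n (e k) y"
      by (simp add: m_def bary_monomial_def monomial_permute[OF \<sigma>] y_def)
    ultimately show ?thesis
      unfolding A K by (simp add: sum_distrib_left sum_distrib_right mult_ac)
  qed
  have "pde_form n a x (\<lambda>i j. partial i (partial j v) x) (\<lambda>i. partial i v x)
    = pde_form n a x
      (\<lambda>i j. \<Sum>k\<in>?B. \<gamma> k * (of_nat (m k j) * bary_monomial_partial n i (dec j (m k)) x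
           - of_nat (m k n) * bary_monomial_partial n i (dec n (m k)) x))
      (\<lambda>i. \<Sum>k\<in>?B. \<gamma> k * bary_monomial_partial n i (m k) x)"
    unfolding v by (rule pde_form_cong, simp only: partial_partial_combination, simp only: partial_combination)
  also have "\<dots> = (\<Sum>k\<in>?B. \<gamma> k *
      ((\<Sum>l\<in>?I. of_nat (k l) * (of_nat (k l) - 1 - of_nat (b l)) * monomial n (e (dec l k)) y)
        - (\<Sum>l\<in>?I. (of_nat (k l) - of_nat (b l)) * of_nat (b n + 1 + (\<Sum>i\<in>?I. k i)) * monomial n (e k) y)))"
    unfolding pde_form_linear pde_form_bary_monomial[OF assms(1)] single ..
  also have "\<dots> =
      (\<Sum>l\<in>?I. \<Sum>k\<in>?B. \<gamma> k * (of_nat (k l) * (of_nat (k l) - 1 - of_nat (b l)) * monomial n (e (dec l k)) y))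
      - (\<Sum>k\<in>?B. \<Sum>l\<in>?I. \<gamma> k * ((of_nat (k l) - of_nat (b l)) * of_nat (b n + 1 + (\<Sum>i\<in>?I. k i)) * monomial n (e k) y))"
    by (subst sum.swap) (simp only: right_diff_distrib sum_subtractf sum_distrib_left)
  also have "(\<Sum>l\<in>?I. \<Sum>k\<in>?B. \<gamma> k * (of_nat (k l) * (of_nat (k l) - 1 - of_nat (b l)) * monomial n (e (dec l k)) y))
    = (\<Sum>l\<in>?I. \<Sum>k\<in>?B. (of_nat (k l) - of_nat (b l)) *
         (of_nat (Suc (k l)) * \<gamma> (k(l := Suc (k l)))) * monomial n (e k) y)"
    by (intro sum.cong refl sum_shift_index)
  also have "\<dots> = (\<Sum>k\<in>?B. \<Sum>l\<in>?I. (of_nat (k l) - of_nat (b l)) *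
         (of_nat (Suc (k l)) * \<gamma> (k(l := Suc (k l)))) * monomial n (e k) y)"
    by (rule sum.swap)
  also have "\<dots> - (\<Sum>k\<in>?B. \<Sum>l\<in>?I. \<gamma> k * ((of_nat (k l) - of_nat (b l)) * of_nat (b n + 1 + (\<Sum>i\<in>?I. k i)) * monomial n (e k) y))
    = (\<Sum>k\<in>?B. recurrence n b \<gamma> k * monomial n (e k) y)"
    unfolding recurrence_def sum_subtractf[symmetric] sum_distrib_right
    by (intro sum.cong refl) (simp only: right_diff_distrib left_diff_distrib mult_ac)
  also have "\<dots> = f_form n b (recurrence n b \<gamma>) y"
    by (simp add: f_form_monomial[OF assms(1)] e_def)
  finally show "pde_form n a x (\<lambda>i j. partial i (partial j v) x) (\<lambda>i. partial i v x)
      = f_form n b (recurrence n b \<gamma>) (complete_point n x \<circ> \<sigma>)"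
    unfolding y_def .
qed

text \<open>
  Every point of the hyperplane of barycentric coordinates is of the form
  \<open>complete_point n x \<circ> \<sigma>\<close>: permuting coordinates preserves the condition that their sum is \<open>1\<close>.
\<close>

lemma complete_point_permute_surj:
  fixes y :: "nat \<Rightarrow> 'a::real_normed_field"
  assumes "n \<ge> 1" and \<sigma>: "\<sigma> permutes {1..n}"
  shows "complete_point n (complete_point n y \<circ> inv \<sigma>) \<circ> \<sigma> = complete_point n y"
proof -
  have In: "{1..n} = insert n {1..n-1}" "n \<notin> {1..n-1}" using assms(1) by auto
  let ?z = "complete_point n y" and ?w = "complete_point n y \<circ> inv \<sigma>"
  have "(\<Sum>i\<in>{1..n-1}. ?z i) = (\<Sum>i\<in>{1..n-1}. y i)"
    by (intro sum.cong) (auto simp: complete_point_def)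
  then have "(\<Sum>i\<in>{1..n}. ?z i) = 1"
    unfolding In(1) using In(2) by (simp add: complete_point_def)
  then have "(\<Sum>i\<in>{1..n}. ?w i) = 1"
    by (subst sum.permute[OF \<sigma>]) (simp add: o_def permutes_inverses[OF \<sigma>])
  then have "1 - (\<Sum>i\<in>{1..n-1}. ?w i) = ?w n"
    unfolding In(1) using In(2) by (simp add: algebra_simps)
  then have "complete_point n ?w = ?w"
    unfolding complete_point_def[of n ?w] by (simp only: fun_upd_triv)
  then show ?thesis by (auto simp: fun_eq_iff permutes_inverses[OF \<sigma>])
qed

text \<open>
  The factor \<open>y\<^sub>n ^ (b\<^sub>n + 1)\<close> has to be cancelled before coefficients can be compared. On the grid of
  nonpositive integers \<open>y\<^sub>n = 1 - \<Sum>\<^sub>i y\<^sub>i\<close> is a positive integer, hence nonzero.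
\<close>

lemma f_form_eq_zero_imp:
  fixes \<delta> :: "(nat \<Rightarrow> nat) \<Rightarrow> 'a::real_normed_field"
  assumes "n \<ge> 1" and \<sigma>: "\<sigma> permutes {1..n}"
    and zero: "\<And>x. f_form n b \<delta> (complete_point n x \<circ> \<sigma>) = 0"
    and k: "k \<in> multi_indices n b"
  shows "\<delta> k = 0"
proof -
  let ?S = "range (\<lambda>j::nat. - of_nat j :: 'a)"
  have "inj (\<lambda>j::nat. - of_nat j :: 'a)" by (auto simp: inj_def)
  then have inf: "infinite ?S" by (rule range_inj_infinite)
  have vanish: "(\<Sum>k\<in>multi_indices n b. \<delta> k * (\<Prod>i\<in>{1..n-1}. y i ^ k i)) = 0"
    if y: "\<And>i. i \<in> {1..n-1} \<Longrightarrow> y i \<in> ?S" for y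
  proof -
    have "\<forall>i\<in>{1..n-1}. \<exists>j::nat. y i = - of_nat j" using y by blast
    then obtain c :: "nat \<Rightarrow> nat" where c: "\<forall>i\<in>{1..n-1}. y i = - of_nat (c i)" by metis
    then have "complete_point n y n = of_nat (Suc (\<Sum>i\<in>{1..n-1}. c i))"
      by (simp add: complete_point_def sum_negf)
    then have nz: "complete_point n y n \<noteq> 0" by (simp only: of_nat_eq_0_iff)
    have "f_form n b \<delta> (complete_point n y) = 0"
      using zero[of "complete_point n y \<circ> inv \<sigma>"] complete_point_permute_surj[OF assms(1) \<sigma>, of y] by simp
    then have "(\<Sum>k\<in>multi_indices n b. \<delta> k * (\<Prod>i\<in>{1..n-1}. complete_point n y i ^ k i)) = 0"
      using nz by (simp add: f_form_def)
    moreover have "(\<Prod>i\<in>{1..n-1}. complete_point n y i ^ k i) = (\<Prod>i\<in>{1..n-1}. y i ^ k i)" for k :: "nat \<Rightarrow> nat"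
      by (intro prod.cong) (auto simp: complete_point_def)
    ultimately show ?thesis by simp
  qed
  have "\<forall>k\<in>(\<Pi>\<^sub>E i\<in>{1..n-1}. {0..b i}). \<delta> k = 0"
    using vanish unfolding multi_indices_def
    by (intro multivariate_coefficients_zero[OF _ inf]) auto
  then show ?thesis
    using k unfolding multi_indices_def by blast
qed

lemma pde_solution_f_form_iff:
  fixes a \<sigma> :: "nat \<Rightarrow> nat" and \<gamma> :: "(nat \<Rightarrow> nat) \<Rightarrow> 'a::real_normed_field"
  assumes "n \<ge> 1" and \<sigma>: "\<sigma> permutes {1..n}"
  shows "pde_solution n a (\<lambda>x. f_form n (a \<circ> \<sigma>) \<gamma> (complete_point n x \<circ> \<sigma>)) \<longleftrightarrow>
    (\<forall>k\<in>multi_indices n (a \<circ> \<sigma>). recurrence n (a \<circ> \<sigma>) \<gamma> k = 0)"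
proof -
  let ?v = "\<lambda>x. f_form n (a \<circ> \<sigma>) \<gamma> (complete_point n x \<circ> \<sigma>)"
  have "pde_solution n a ?v \<longleftrightarrow>
      (\<forall>x. f_form n (a \<circ> \<sigma>) (recurrence n (a \<circ> \<sigma>) \<gamma>) (complete_point n x \<circ> \<sigma>) = 0)"
    using pde_operator_f_form[OF assms, where a=a and \<gamma>=\<gamma>] unfolding pde_solution_def pde_form_def by simp
  also have "\<dots> \<longleftrightarrow> (\<forall>k\<in>multi_indices n (a \<circ> \<sigma>). recurrence n (a \<circ> \<sigma>) \<gamma> k = 0)"
    using f_form_eq_zero_imp[OF assms, of "a \<circ> \<sigma>" "recurrence n (a \<circ> \<sigma>) \<gamma>"]
    by (auto simp: f_form_def)
  finally show ?thesis .
qed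

section \<open>Solving the recurrence\<close>

definition pochhammer_coeff :: "nat \<Rightarrow> (nat \<Rightarrow> nat) \<Rightarrow> (nat \<Rightarrow> nat) \<Rightarrow> 'a::field_char_0" where
  "pochhammer_coeff n b k =
     pochhammer (of_nat (b n + 1)) (\<Sum>i\<in>{1..n-1}. k i) / (\<Prod>i\<in>{1..n-1}. fact (k i))"

lemma f_poly_eq_f_form: "f_poly n b y = f_form n b (pochhammer_coeff n b) y"
  by (simp add: f_poly_def f_form_def pochhammer_coeff_def)

lemma pochhammer_coeff_nonzero: "pochhammer_coeff n b k \<noteq> (0 :: 'a::field_char_0)"
proof -
  have "pochhammer (of_nat (b n + 1) :: 'a) j \<noteq> 0" for j
    by (metis of_nat_eq_0_iff pochhammer_of_nat pochhammer_pos add_gr_0 less_one not_less0)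
  then show ?thesis by (simp add: pochhammer_coeff_def)
qed

text \<open>
  This says that every bracket in \<open>recurrence\<close> vanishes for the Pochhammer coefficients.
  It follows from \<open>(B)\<^bsub>s+1\<^esub> = (B)\<^sub>s (B + s)\<close> and \<open>(k\<^sub>l + 1)! = (k\<^sub>l + 1) k\<^sub>l!\<close>.
\<close>

lemma pochhammer_coeff_Suc:
  assumes l: "l \<in> {1..n-1}"
  shows "of_nat (Suc (k l)) * pochhammer_coeff n b (k(l := Suc (k l)))
    = of_nat (b n + 1 + (\<Sum>i\<in>{1..n-1}. k i)) * (pochhammer_coeff n b k :: 'a::field_char_0)"
proof -
  have s: "(\<Sum>i\<in>{1..n-1}. (k(l := Suc (k l))) i) = Suc (\<Sum>i\<in>{1..n-1}. k i)"
  proof -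
    have "(\<Sum>i\<in>{1..n-1}-{l}. (k(l := Suc (k l))) i) = (\<Sum>i\<in>{1..n-1}-{l}. k i)"
      by (intro sum.cong) auto
    then show ?thesis using l by (simp add: sum.remove[of _ l])
  qed
  have p: "(\<Prod>i\<in>{1..n-1}. fact ((k(l := Suc (k l))) i) :: 'a)
      = of_nat (Suc (k l)) * (\<Prod>i\<in>{1..n-1}. fact (k i))"
  proof -
    have "(\<Prod>i\<in>{1..n-1}-{l}. fact ((k(l := Suc (k l))) i) :: 'a) = (\<Prod>i\<in>{1..n-1}-{l}. fact (k i))"
      by (intro prod.cong) auto
    then show ?thesis using l by (simp add: prod.remove[of _ l] mult_ac)
  qed
  have "S * (q * r / (S * Q)) = r * (q / Q)" if "S \<noteq> 0" for S q r Q :: 'a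
    using that by simp
  moreover have "of_nat (Suc (k l)) \<noteq> (0 :: 'a)" by (simp only: of_nat_eq_0_iff)
  ultimately show ?thesis
    unfolding pochhammer_coeff_def s p pochhammer_Suc of_nat_add[symmetric] by blast
qed

lemma recurrence_pochhammer_coeff:
  "recurrence n b (pochhammer_coeff n b :: _ \<Rightarrow> 'a::field_char_0) k = 0"
  unfolding recurrence_def by (intro sum.neutral ballI) (simp only: pochhammer_coeff_Suc diff_self mult_zero_right)

lemma recurrence_linear:
  "recurrence n b (\<lambda>k. \<gamma> k - c * \<gamma>' k) k = recurrence n b \<gamma> k - c * recurrence n b \<gamma>' k"
  unfolding recurrence_def
  by (simp only: sum_distrib_left sum_subtractf[symmetric], intro sum.cong refl)
     (simp only: right_diff_distrib left_diff_distrib mult_ac, simp)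

text \<open>
  Downward induction from the top corner, by the distance \<open>\<Sum>\<^sub>l (b\<^sub>l - k\<^sub>l)\<close>. The values at \<open>k + e\<^sub>l\<close>
  are zero by induction, or carry the factor \<open>k\<^sub>l - b\<^sub>l = 0\<close> if \<open>k + e\<^sub>l\<close> lies outside the box. What
  remains of the recurrence is a positive integer multiple of \<open>\<delta> k\<close>.
\<close>

lemma recurrence_determined_by_top:
  fixes \<delta> :: "(nat \<Rightarrow> nat) \<Rightarrow> 'a::field_char_0"
  assumes rec: "\<And>k. k \<in> multi_indices n b \<Longrightarrow> recurrence n b \<delta> k = 0"
    and top: "\<delta> (restrict b {1..n-1}) = 0"
    and "k \<in> multi_indices n b"
  shows "\<delta> k = 0"
  using assms(3)
proof (induction "\<Sum>l\<in>{1..n-1}. b l - k l" arbitrary: k rule: less_induct)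
  case less
  let ?I = "{1..n-1}"
  have le: "k l \<le> b l" if "l \<in> ?I" for l using multi_indices_le[OF less.prems that] .
  show ?case
  proof (cases "k = restrict b ?I")
    case True
    then show ?thesis using top by simp
  next
    case False
    have "\<exists>l\<in>?I. k l < b l"
    proof (rule ccontr)
      assume "\<not> ?thesis"
      then have "k l = restrict b ?I l" for l
        using le less.prems by (cases "l \<in> ?I") (force simp: multi_indices_def PiE_def extensional_def)+
      then show False using False by auto
    qed
    then have pos: "(\<Sum>l\<in>?I. b l - k l) > 0" by (auto intro: sum_pos2)
    let ?K = "b n + 1 + (\<Sum>i\<in>?I. k i)"
    have step: "(of_nat (k l) - of_nat (b l)) * \<delta> (k(l := Suc (k l))) = 0" if l: "l \<in> ?I" for l
    proof (cases "k l < b l")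
      case True
      have "(\<Sum>i\<in>?I. b i - (k(l := Suc (k l))) i) < (\<Sum>i\<in>?I. b i - k i)"
        by (rule sum_strict_mono_ex1) (use l True in auto)
      moreover have "k(l := Suc (k l)) \<in> multi_indices n b"
        using multi_indices_upd[OF less.prems l] True by simp
      ultimately have "\<delta> (k(l := Suc (k l))) = 0" by (rule less.hyps)
      then show ?thesis by simp
    next
      case False
      then show ?thesis using le[OF l] by simp
    qed
    have "0 = recurrence n b \<delta> k" using rec[OF less.prems] by simp
    also have "\<dots> = (\<Sum>l\<in>?I. of_nat (b l - k l) * (of_nat ?K * \<delta> k))"
      unfolding recurrence_def
    proof (intro sum.cong refl)
      fix l assume l: "l \<in> ?I"
      have "(of_nat (k l) - of_nat (b l)) * (of_nat (Suc (k l)) * \<delta> (k(l := Suc (k l))) - of_nat ?K * \<delta> k)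
        = of_nat (Suc (k l)) * ((of_nat (k l) - of_nat (b l)) * \<delta> (k(l := Suc (k l))))
          + (of_nat (b l) - of_nat (k l)) * (of_nat ?K * \<delta> k)"
        by (simp only: right_diff_distrib left_diff_distrib mult_ac) simp
      then show "(of_nat (k l) - of_nat (b l)) * (of_nat (Suc (k l)) * \<delta> (k(l := Suc (k l))) - of_nat ?K * \<delta> k)
        = of_nat (b l - k l) * (of_nat ?K * \<delta> k)"
        unfolding step[OF l] using le[OF l] by (simp only: of_nat_diff mult_zero_right add_0)
    qed
    also have "\<dots> = of_nat (\<Sum>l\<in>?I. b l - k l) * (of_nat ?K * \<delta> k)"
      by (simp only: sum_distrib_right of_nat_sum)
    finally have "of_nat (\<Sum>l\<in>?I. b l - k l) * (of_nat ?K * \<delta> k) = 0" by simp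
    then show ?thesis using pos by (auto simp only: mult_eq_0_iff of_nat_eq_0_iff)
  qed
qed

theorem theorem11p2:
  fixes n :: nat and a :: "nat \<Rightarrow> nat" and \<sigma> :: "nat \<Rightarrow> nat"
    and F :: "(nat \<Rightarrow> 'a::real_normed_field) \<Rightarrow> 'a"
  assumes "n \<ge> 2"
    and "\<sigma> permutes {1..n}"
  defines "F \<equiv> \<lambda>x. f_poly n (a \<circ> \<sigma>) (complete_point n x \<circ> \<sigma>)"
  shows "pde_solution n a F
    \<and> (\<exists>\<gamma>. F = (\<lambda>x. f_form n (a \<circ> \<sigma>) \<gamma> (complete_point n x \<circ> \<sigma>)))
    \<and> (\<forall>v. pde_solution n a v \<and> (\<exists>\<gamma>. v = (\<lambda>x. f_form n (a \<circ> \<sigma>) \<gamma> (complete_point n x \<circ> \<sigma>)))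
           \<longrightarrow> (\<exists>c. v = (\<lambda>x. c * F x)))"
proof (intro conjI allI impI)
  define b where "b = a \<circ> \<sigma>"
  define p :: "(nat \<Rightarrow> nat) \<Rightarrow> 'a" where "p = pochhammer_coeff n b"
  have n: "n \<ge> 1" using assms(1) by simp
  have F: "F = (\<lambda>x. f_form n b p (complete_point n x \<circ> \<sigma>))"
    by (simp add: F_def f_poly_eq_f_form p_def b_def)
  have p: "recurrence n b p k = 0" for k
    by (simp add: p_def recurrence_pochhammer_coeff)
  show "pde_solution n a F"
    using p unfolding F b_def by (simp add: pde_solution_f_form_iff[OF n assms(2)])
  show "\<exists>\<gamma>. F = (\<lambda>x. f_form n (a \<circ> \<sigma>) \<gamma> (complete_point n x \<circ> \<sigma>))"
    using F unfolding b_def by blast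
  fix v :: "(nat \<Rightarrow> 'a) \<Rightarrow> 'a"
  assume "pde_solution n a v \<and> (\<exists>\<gamma>. v = (\<lambda>x. f_form n (a \<circ> \<sigma>) \<gamma> (complete_point n x \<circ> \<sigma>)))"
  then obtain \<gamma> where v: "v = (\<lambda>x. f_form n b \<gamma> (complete_point n x \<circ> \<sigma>))"
    and sol: "pde_solution n a v" unfolding b_def by blast
  have \<gamma>: "recurrence n b \<gamma> k = 0" if "k \<in> multi_indices n b" for k
    using sol that unfolding v b_def by (simp add: pde_solution_f_form_iff[OF n assms(2)])
  let ?top = "restrict b {1..n-1}"
  \<comment> \<open>the factor for which the top coefficients of \<open>v\<close> and \<open>c * F\<close> agree\<close>
  define c where "c = \<gamma> ?top / p ?top"
  have diff: "\<gamma> k - c * p k = 0" if "k \<in> multi_indices n b" for k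
  proof (rule recurrence_determined_by_top[where \<delta> = "\<lambda>k. \<gamma> k - c * p k", OF _ _ that])
    show "\<gamma> ?top - c * p ?top = 0"
      using pochhammer_coeff_nonzero[of n b ?top, where 'a='a] by (simp add: c_def p_def)
  qed (simp only: recurrence_linear \<gamma> p mult_zero_right diff_0_right)
  have "f_form n b \<gamma> y - c * f_form n b p y = 0" for y
    unfolding f_form_linear[symmetric] using diff by (simp add: f_form_def)
  then show "\<exists>c. v = (\<lambda>x. c * F x)"
    unfolding v F by (intro exI[of _ c]) auto
qed

end
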